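(* Let $T$ be a triangle mesh tessellating a planar region, with vertex set $V$ and set of triangles $F$, and let $\Theta=(\Theta_i)_{i\in V}\in\mathbb{R}^{|V|}$ be arbitrary. Then the energy functional $\mathcal{E}$ is a concave function on the set $\mathbf{L}_{T,\Theta}$ of angle structures of $T$ with prescribed angle sums $\Theta$. Furthermore, if $A\in\mathbf{L}_{T,\Theta}$ is an extremal point of $\mathcal{E}$ restricted to $\mathbf{L}_{T,\Theta}$, then $H(i,A)=0$ for every interior vertex $i$ of $T$, where $H(i,A)$ is the holonomy at $i$.
   Context: A triangle mesh $T$ here is a finite triangulation of a compact planar region (a surface with boundary), with vertex set $V=\{1,\dots,n\}$ and set of triangles $F$; only its combinatorial structure is kept fixed. A vertex is interior if it does not lie on the boundary, so that the triangles incident to it form a closed cycle around it. The triangle with vertices $i,j,k$ is denoted $ijk$. An angle structure assigns to each triangle $ijk\in F$ and each of its vertices a real number, where $\alpha^i_{jk}$ is the number (the "inner angle") assigned at vertex $i$ in triangle $ijk$. The set of angle structures is $$\mathbf{A}_T=\Big\{(\dots,\alpha^i_{jk},\alpha^j_{ki},\alpha^k_{ij},\dots)\in\mathbb{R}^{3|F|} : \text{for all } ijk\in F,\ \alpha^i_{jk}+\alpha^j_{ki}+\alpha^k_{ij}=\pi,\ \alpha^i_{jk}>0,\ \alpha^j_{ki}>0,\ \alpha^k_{ij}>0\Big\}.$$ The angle sum of $A\in\mathbf{A}_T$ at vertex $i$ is $\Theta(i,A)=\sum_{jk:\,ijk\in F}\alpha^i_{jk}$, and $$\mathbf{L}_{T,\Theta}=\{A\in\mathbf{A}_T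 : \Theta(i,A)=\Theta_i \text{ for all } i\in V\}.$$ The holonomy of $A\in\mathbf{A}_T$ at vertex $i$ is $$H(i,A)=\sum_{jk:\,ijk\in F}\big(\ln\sin\alpha^k_{ij}-\ln\sin\alpha^j_{ki}\big),$$ where the sum has one term for each triangle incident to $i$, and each such triangle is written $ijk$ with its vertices $i,j,k$ in the cyclic order given by a fixed orientation of the plane (counterclockwise). The Lobachevsky function is $\Lambda(x)=-\int_0^x \ln|2\sin t|\,dt$. The energy functional $\mathcal{E}:\mathbf{A}_T\to\mathbb{R}$ is $$\mathcal{E}(A)=\sum_{ijk\in F}\big(\Lambda(\alpha^i_{jk})+\Lambda(\alpha^j_{ki})+\Lambda(\alpha^k_{ij})\big).$$ An extremal point of $\mathcal{E}$ on $\mathbf{L}_{T,\Theta}$ is a point at which the restriction of $\mathcal{E}$ to $\mathbf{L}_{T,\Theta}$ has a local extremum. *)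

theory Defs
  imports "HOL-Analysis.Analysis"
begin

text \<open>
  Vertices and triangles are indexed by finite types \<open>'v\<close> and \<open>'f\<close>. The corners of a triangle are
  indexed by the three-element type \<open>3\<close>, whose arithmetic is modulo 3: \<open>tri f c\<close> is the vertex at
  corner \<open>c\<close> of \<open>f\<close>, and \<open>c\<close>, \<open>c + 1\<close>, \<open>c + 2\<close> run through the corners counterclockwise. So if
  \<open>i = tri f c\<close>, \<open>j = tri f (c + 1)\<close> and \<open>k = tri f (c + 2)\<close>, then \<open>f\<close> is the triangle \<open>ijk\<close>.
  An assignment of a real number to every corner, i.e. an element of \<open>\<real>\<close> to the power \<open>3|F|\<close>,
  is an element \<open>A\<close> of \<open>real^3^'f\<close>; the angle at vertex \<open>i\<close> of \<open>ijk\<close> is \<open>A $ f $ c\<close>.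
\<close>

definition counterclockwise :: "complex \<Rightarrow> complex \<Rightarrow> complex \<Rightarrow> bool" where
  "counterclockwise a b c \<longleftrightarrow> 0 < Im (cnj (b - a) * (c - a))"

definition cell :: "('v \<Rightarrow> complex) \<Rightarrow> ('f \<Rightarrow> 3 \<Rightarrow> 'v) \<Rightarrow> 'f \<Rightarrow> complex set" where
  "cell p tri f = convex hull (range (\<lambda>c. p (tri f c)))"

definition region :: "('v \<Rightarrow> complex) \<Rightarrow> ('f \<Rightarrow> 3 \<Rightarrow> 'v) \<Rightarrow> complex set" where
  "region p tri = (\<Union>f. cell p tri f)"

text \<open>Locally homeomorphic to the closed half-plane. Second countability and the Hausdorff
  property are automatic for subsets of the plane.\<close>

definition surface_with_boundary :: "complex set \<Rightarrow> bool" where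
  "surface_with_boundary S \<longleftrightarrow>
     (\<forall>x\<in>S. \<exists>U W. openin (top_of_set S) U \<and> x \<in> U \<and>
        openin (top_of_set {z. 0 \<le> Im z}) W \<and> U homeomorphic W)"

text \<open>The positions \<open>p\<close> only realise the mesh in the plane, to say which region it tessellates,
  what its orientation is and which vertices lie on the boundary; angle structures, angle sums,
  holonomy and energy do not involve them.\<close>

definition triangle_mesh :: "('v::finite \<Rightarrow> complex) \<Rightarrow> ('f::finite \<Rightarrow> 3 \<Rightarrow> 'v) \<Rightarrow> bool" where
  "triangle_mesh p tri \<longleftrightarrow>
     inj p \<and>
     (\<forall>v. \<exists>f c. tri f c = v) \<and>
     (\<forall>f. counterclockwise (p (tri f 1)) (p (tri f 2)) (p (tri f 3))) \<and>
     inj (cell p tri) \<and>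
     triangulation (range (cell p tri)) \<and>
     surface_with_boundary (region p tri)"

text \<open>For a compact surface with boundary embedded in the plane, the boundary of the surface is its
  topological frontier.\<close>

definition interior_vertex :: "('v \<Rightarrow> complex) \<Rightarrow> ('f \<Rightarrow> 3 \<Rightarrow> 'v) \<Rightarrow> 'v \<Rightarrow> bool" where
  "interior_vertex p tri v \<longleftrightarrow> p v \<notin> frontier (region p tri)"

definition angle_structures :: "(real^3^'f) set" where
  "angle_structures =
     {A. \<forall>f. A $ f $ 1 + A $ f $ 2 + A $ f $ 3 = pi \<and> (\<forall>c. 0 < A $ f $ c)}"

definition angle_sum :: "('f::finite \<Rightarrow> 3 \<Rightarrow> 'v) \<Rightarrow> 'v \<Rightarrow> real^3^'f \<Rightarrow> real" where
  "angle_sum tri v A = (\<Sum>(f, c) \<in> {(f, c). tri f c = v}. A $ f $ c)"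

definition prescribed_angle_structures ::
  "('f::finite \<Rightarrow> 3 \<Rightarrow> 'v::finite) \<Rightarrow> real^'v \<Rightarrow> (real^3^'f) set" where
  "prescribed_angle_structures tri \<Theta> = {A \<in> angle_structures. \<forall>v. angle_sum tri v A = \<Theta> $ v}"

definition holonomy :: "('f::finite \<Rightarrow> 3 \<Rightarrow> 'v) \<Rightarrow> 'v \<Rightarrow> real^3^'f \<Rightarrow> real" where
  "holonomy tri v A =
     (\<Sum>(f, c) \<in> {(f, c). tri f c = v}. ln (sin (A $ f $ (c + 2))) - ln (sin (A $ f $ (c + 1))))"

definition Lobachevsky :: "real \<Rightarrow> real" where
  "Lobachevsky x = - (LBINT t=0..ereal x. ln \<bar>2 * sin t\<bar>)"

definition energy :: "real^3^'f::finite \<Rightarrow> real" where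
  "energy A = (\<Sum>f\<in>UNIV. \<Sum>c\<in>UNIV. Lobachevsky (A $ f $ c))"

definition extremal_point_on :: "('a::topological_space) set \<Rightarrow> ('a \<Rightarrow> real) \<Rightarrow> 'a \<Rightarrow> bool" where
  "extremal_point_on S f x \<longleftrightarrow> x \<in> S \<and>
     ((\<forall>\<^sub>F y in at x within S. f y \<le> f x) \<or> (\<forall>\<^sub>F y in at x within S. f x \<le> f y))"

end

theory Submission
  imports Defs
begin

text \<open>
  On \<open>(0, \<pi>)\<close> the Lobachevsky function has derivative \<open>- ln (2 sin x)\<close>, so along a direction
  \<open>(u, v, w)\<close> with \<open>u + v + w = 0\<close> the second derivative of the energy of one triangle is
  \<open>- (u\<^sup>2 cot a + v\<^sup>2 cot b + w\<^sup>2 cot c)\<close>. Since the angles sum to \<open>\<pi>\<close>, this form multiplied by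
  \<open>cot a + cot b > 0\<close> is minus a sum of two squares, whence concavity.

  For a vertex \<open>v\<close>, increase the angle at the last corner of each triangle at \<open>v\<close> and decrease the
  angle at the middle corner by the same amount. The derivative of the energy in this direction is
  minus the holonomy at \<open>v\<close>. If \<open>v\<close> is interior, every edge at \<open>v\<close> has exactly one triangle on
  each side, so the direction preserves all angle sums, and the derivative vanishes at an extremal
  point.
\<close>

section \<open>Lobachevsky function: integrability and derivative\<close>

text \<open>The constant \<open>pi / 3\<close> is where the cosine drops to \<open>1 / 2\<close>, so
  \<open>sin t - t / 2\<close> is nondecreasing up to there.\<close>

lemma half_le_sin:
  fixes t :: real
  assumes "0 \<le> t" "t \<le> pi / 3"
  shows "t / 2 \<le> sin t"
proof -
  have "sin 0 - 0 / 2 \<le> sin t - t / 2"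
  proof (rule DERIV_nonneg_imp_nondecreasing[OF assms(1)])
    fix x assume x: "0 \<le> x" "x \<le> t"
    have "cos (pi / 3) \<le> cos x"
      using x assms by (intro cos_monotone_0_pi_le) auto
    then show "\<exists>y. ((\<lambda>t. sin t - t / 2) has_real_derivative y) (at x) \<and> 0 \<le> y"
      by (intro exI[of _ "cos x - 1 / 2"]) (auto intro!: derivative_eq_intros simp: cos_60)
  qed
  then show ?thesis by simp
qed

text \<open>An integrable majorant at the singularity 0. Since \<open>2 * sin t\<close> lies between
  \<open>t\<close> and 2, only \<open>ln 2\<close> and \<open>- ln t\<close>, which is twice
  \<open>ln (1 / sqrt t)\<close>, need bounding.\<close>

lemma abs_ln_sin_le:
  fixes t :: real
  assumes "0 < t" "t \<le> pi / 3"
  shows "\<bar>ln \<bar>2 * sin t\<bar>\<bar> \<le> 2 / sqrt t"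
proof -
  have s: "t \<le> 2 * sin t" "2 * sin t \<le> 2"
    using half_le_sin[of t] assms by auto
  have "ln (1 / sqrt t) \<le> 1 / sqrt t - 1"
    using assms by (intro ln_le_minus_one) auto
  then have "- ln t \<le> 2 / sqrt t - 2"
    using assms by (simp add: ln_div ln_sqrt)
  moreover have "ln t \<le> ln (2 * sin t)" "ln (2 * sin t) \<le> ln 2"
    using s assms by auto
  moreover have "ln 2 \<le> (1::real)"
    using ln_le_minus_one[of 2] by simp
  moreover have "sqrt t \<le> 2"
    using assms pi_less_4 by (intro real_le_lsqrt) auto
  then have "1 \<le> 2 / sqrt t"
    using assms by (simp add: field_simps)
  moreover have "\<bar>2 * sin t\<bar> = 2 * sin t"
    using s assms by simp
  ultimately show ?thesis
    by (simp only: abs_le_iff) linarith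
qed

text \<open>Up to \<open>pi / 3\<close> the majorant \<open>2 / sqrt t\<close>, with antiderivative
  \<open>4 * sqrt t\<close>, applies; from there to \<open>x\<close> the integrand is continuous, as
  \<open>sin\<close> has no zero. If \<open>x < pi / 3\<close>, the second interval is
  empty.\<close>

lemma set_integrable_ln_sin:
  fixes x :: real
  assumes "0 < x" "x < pi"
  shows "set_integrable lborel {0<..<x} (\<lambda>t. ln \<bar>2 * sin t\<bar>)"
proof -
  have "set_integrable lborel (einterval 0 (ereal (pi / 3))) (\<lambda>t. 2 / sqrt t)"
  proof (rule interval_integral_FTC_nonneg(1))
    fix t :: real assume "0 < ereal t"
    then have t: "0 < t" by simp
    show "((\<lambda>t. 4 * sqrt t) has_real_derivative 2 / sqrt t) (at t)"
      using t by (auto intro!: derivative_eq_intros simp: field_simps)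
    show "isCont (\<lambda>t. 2 / sqrt t) t"
      using t by (auto intro!: continuous_intros)
  next
    show "(((\<lambda>t. 4 * sqrt t) \<circ> real_of_ereal) \<longlongrightarrow> 4 * sqrt 0) (at_right 0)"
      unfolding zero_ereal_def
      by (simp only: ereal_tendsto_simps) (intro tendsto_intros)
    show "(((\<lambda>t. 4 * sqrt t) \<circ> real_of_ereal) \<longlongrightarrow> 4 * sqrt (pi / 3)) (at_left (ereal (pi / 3)))"
      by (simp only: ereal_tendsto_simps) (intro tendsto_intros)
  qed (auto)
  then have "set_integrable lborel {0<..<pi / 3} (\<lambda>t. 2 / sqrt t)"
    by (simp add: zero_ereal_def)
  then have "set_integrable lborel {0<..<pi / 3} (\<lambda>t. ln \<bar>2 * sin t\<bar>)"
  proof (rule set_integrable_bound)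
    show "set_borel_measurable lborel {0<..<pi / 3} (\<lambda>t. ln \<bar>2 * sin t\<bar>)"
      unfolding set_borel_measurable_def by measurable
    show "AE t in lborel. t \<in> {0<..<pi / 3} \<longrightarrow> norm (ln \<bar>2 * sin t\<bar>) \<le> norm (2 / sqrt t)"
      using abs_ln_sin_le by auto
  qed
  moreover have "set_integrable lborel {pi / 3..x} (\<lambda>t. ln \<bar>2 * sin t\<bar>)"
  proof (rule borel_integrable_atLeastAtMost')
    have "sin t \<noteq> 0" if "t \<in> {pi / 3..x}" for t
      using that assms sin_gt_zero[of t] pi_gt_zero by force
    then show "continuous_on {pi / 3..x} (\<lambda>t. ln \<bar>2 * sin t\<bar>)"
      by (auto intro!: continuous_intros)
  qed
  ultimately have "set_integrable lborel ({0<..<pi / 3} \<union> {pi / 3..x}) (\<lambda>t. ln \<bar>2 * sin t\<bar>)"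
    by (rule set_integrable_Un) auto
  then show ?thesis
    by (rule set_integrable_subset) auto
qed

text \<open>The integrand is singular at 0, so the fundamental theorem is applied from a base point
  \<open>a > 0\<close>; the integral from 0 to \<open>a\<close> only adds a constant.\<close>

lemma DERIV_Lobachevsky:
  assumes "0 < x" "x < pi"
  shows "(Lobachevsky has_real_derivative - ln (2 * sin x)) (at x)"
proof -
  define f :: "real \<Rightarrow> real" where "f t = ln \<bar>2 * sin t\<bar>" for t
  obtain a b where ab: "0 < a" "a < x" "x < b" "b < pi"
    using assms dense by metis
  have "((\<lambda>u. LBINT t=a..u. f t) has_vector_derivative f x) (at x within {a..b})"
  proof (rule interval_integral_FTC2)
    have "sin t \<noteq> 0" if "t \<in> {a..b}" for t
      using that ab sin_gt_zero[of t] by force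
    then show "continuous_on {a..b} f"
      unfolding f_def by (auto intro!: continuous_intros)
  qed (use ab in auto)
  then have "((\<lambda>u. LBINT t=a..u. f t) has_real_derivative f x) (at x)"
    using ab by (simp add: at_within_Icc_at has_real_derivative_iff_has_vector_derivative)
  then have "((\<lambda>u. - ((LBINT t=0..a. f t) + (LBINT t=a..u. f t))) has_real_derivative - f x) (at x)"
    by (auto intro!: derivative_eq_intros)
  then have "(Lobachevsky has_real_derivative - f x) (at x)"
  proof (rule has_field_derivative_transform_within_open[where S = "{a<..<b}"])
    fix u assume u: "u \<in> {a<..<b}"
    have "(LBINT t=ereal 0..a. f t) + (LBINT t=a..u. f t) = (LBINT t=ereal 0..u. f t)"
    proof (rule interval_integral_sum)
      show "interval_lebesgue_integrable lborel (min (ereal 0) (min (ereal a) (ereal u)))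
          (max (ereal 0) (max (ereal a) (ereal u))) f"
        using set_integrable_ln_sin[of u] u ab
        by (simp add: interval_lebesgue_integrable_def f_def[abs_def] min_def max_def)
    qed
    then show "- ((LBINT t=0..a. f t) + (LBINT t=a..u. f t)) = Lobachevsky u"
      by (simp add: Lobachevsky_def f_def zero_ereal_def)
  qed (use ab in auto)
  then show ?thesis
    using sin_gt_zero[OF assms] by (simp add: f_def)
qed

section \<open>Concavity of the energy\<close>

text \<open>The angles of a triangle satisfy
  \<open>cot a * cot b + cot b * cot c + cot c * cot a = 1\<close>. This eliminates
  \<open>cot c\<close>, and completing squares leaves
  \<open>(cot a * u - cot b * v)\<^sup>2 + (u + v)\<^sup>2\<close>.\<close>

lemma cot_form_nonneg:
  fixes u v w :: real
  assumes "a + b + c = pi" "0 < a" "0 < b" "0 < c" and uvw: "u + v + w = 0"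
  shows "0 \<le> cot a * u\<^sup>2 + cot b * v\<^sup>2 + cot c * w\<^sup>2"
proof -
  have c: "c = pi - (a + b)" and w: "w = - (u + v)"
    using assms by auto
  have s: "sin a > 0" "sin b > 0" "sin (a + b) > 0"
    using assms by (auto intro!: sin_gt_zero)
  have sum: "cot a + cot b = sin (a + b) / (sin a * sin b)"
    using s by (simp add: cot_def sin_add field_simps)
  then have pos: "0 < cot a + cot b"
    using s by simp
  have "cot c = - (cos (a + b) / sin (a + b))"
    by (simp add: c cot_def)
  then have "(cot a + cot b) * cot c = - cos (a + b) / (sin a * sin b)"
    using s by (simp add: sum)
  also have "\<dots> = 1 - cot a * cot b"
    using s by (simp add: cot_def cos_add field_simps)
  finally have "(cot a + cot b) * cot c = 1 - cot a * cot b" .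
  then have "(cot a + cot b) * (cot a * u\<^sup>2 + cot b * v\<^sup>2 + cot c * w\<^sup>2)
      = (cot a + cot b) * (cot a * u\<^sup>2 + cot b * v\<^sup>2) + (1 - cot a * cot b) * w\<^sup>2"
    by (simp add: distrib_left mult.assoc[symmetric])
  also have "\<dots> = (cot a * u - cot b * v)\<^sup>2 + (u + v)\<^sup>2"
    unfolding w by (simp add: power2_eq_square algebra_simps)
  finally have "0 \<le> (cot a + cot b) * (cot a * u\<^sup>2 + cot b * v\<^sup>2 + cot c * w\<^sup>2)"
    by simp
  then show ?thesis
    using pos by (simp add: zero_le_mult_iff)
qed

lemma angle_bounds:
  assumes "A \<in> angle_structures"
  shows "0 < A $ f $ c" "A $ f $ c < pi"
proof -
  have pos: "0 < A $ f $ d" for d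
    using assms by (auto simp: angle_structures_def)
  have sum: "A $ f $ 1 + A $ f $ 2 + A $ f $ 3 = pi"
    using assms by (auto simp: angle_structures_def)
  show "0 < A $ f $ c" by (rule pos)
  show "A $ f $ c < pi"
    using pos[of 1] pos[of 2] pos[of 3] sum exhaust_3[of c] by auto
qed

lemma convex_angle_structures: "convex angle_structures"
proof (rule convexI)
  fix A B :: "real^3^'f" and u v :: real
  assume AB: "A \<in> angle_structures" "B \<in> angle_structures" and uv: "0 \<le> u" "0 \<le> v" "u + v = 1"
  have "u * A $ f $ 1 + v * B $ f $ 1 + (u * A $ f $ 2 + v * B $ f $ 2) +
      (u * A $ f $ 3 + v * B $ f $ 3) = pi" for f
  proof -
    have "u * A $ f $ 1 + v * B $ f $ 1 + (u * A $ f $ 2 + v * B $ f $ 2) +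
        (u * A $ f $ 3 + v * B $ f $ 3) =
        u * (A $ f $ 1 + A $ f $ 2 + A $ f $ 3) + v * (B $ f $ 1 + B $ f $ 2 + B $ f $ 3)"
      by (simp add: algebra_simps)
    also have "\<dots> = (u + v) * pi"
      using AB by (simp add: angle_structures_def distrib_right)
    finally show ?thesis using uv by simp
  qed
  moreover have "0 < u * A $ f $ c + v * B $ f $ c" for f c
  \<comment> \<open>The weights cannot both vanish; the strict sign comes from a positive
    one.\<close>
  proof (cases "u = 0")
    case True
    then show ?thesis using uv angle_bounds(1)[OF AB(2)] by simp
  next
    case False
    then show ?thesis
      using uv angle_bounds(1)[OF AB(1), of f c] angle_bounds(1)[OF AB(2), of f c]
      by (intro add_pos_nonneg mult_pos_pos mult_nonneg_nonneg) auto
  qed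
  ultimately show "u *\<^sub>R A + v *\<^sub>R B \<in> angle_structures"
    by (simp add: angle_structures_def)
qed

lemma angle_sum_linear: "linear (angle_sum tri v)"
  by (rule linearI)
     (simp_all add: angle_sum_def case_prod_unfold sum.distrib sum_distrib_left)

lemma convex_prescribed_angle_structures: "convex (prescribed_angle_structures tri \<Theta>)"
proof (rule convexI)
  fix A B and x y :: real
  assume *: "A \<in> prescribed_angle_structures tri \<Theta>" "B \<in> prescribed_angle_structures tri \<Theta>"
    "0 \<le> x" "0 \<le> y" "x + y = 1"
  then have "x *\<^sub>R A + y *\<^sub>R B \<in> angle_structures"
    using convex_angle_structures by (auto simp: prescribed_angle_structures_def convex_def)
  moreover have "x * t + y * t = t" for t
    using * by (metis distrib_right mult_1)
  ultimately show "x *\<^sub>R A + y *\<^sub>R B \<in> prescribed_angle_structures tri \<Theta>"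
    using * by (simp add: prescribed_angle_structures_def linear_add[OF angle_sum_linear]
      linear_cmul[OF angle_sum_linear])
qed

lemma energy_has_derivative:
  assumes "A + t *\<^sub>R D \<in> angle_structures"
  shows "((\<lambda>t. energy (A + t *\<^sub>R D)) has_real_derivative
    (\<Sum>f\<in>UNIV. \<Sum>c\<in>UNIV. - ln (2 * sin ((A + t *\<^sub>R D) $ f $ c)) * D $ f $ c)) (at t)"
  unfolding energy_def
proof (intro DERIV_sum)
  fix f c
  have L: "(Lobachevsky has_real_derivative - ln (2 * sin ((A + t *\<^sub>R D) $ f $ c)))
      (at ((A + t *\<^sub>R D) $ f $ c))"
    by (intro DERIV_Lobachevsky angle_bounds[OF assms])
  have "((\<lambda>t. (A + t *\<^sub>R D) $ f $ c) has_real_derivative D $ f $ c) (at t)"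
    by (auto intro!: derivative_eq_intros)
  from DERIV_chain2[OF L this]
  show "((\<lambda>t. Lobachevsky ((A + t *\<^sub>R D) $ f $ c)) has_real_derivative
    - ln (2 * sin ((A + t *\<^sub>R D) $ f $ c)) * D $ f $ c) (at t)" .
qed

text \<open>Concavity is tested on segments by the second derivative. All points of a segment, ends
  included, are angle structures, so two-sided derivatives exist throughout.\<close>

lemma concave_on_energy: "concave_on angle_structures energy"
proof -
  have "(1 - u) * energy A + u * energy B \<le> energy ((1 - u) *\<^sub>R A + u *\<^sub>R B)"
    if AB: "A \<in> angle_structures" "B \<in> angle_structures" and u: "0 < u" "u < 1"
    for A B :: "real^3^'f" and u :: real
  proof -
    define D where "D = B - A"
    have line: "A + t *\<^sub>R D = (1 - t) *\<^sub>R A + t *\<^sub>R B" for t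
      by (simp add: D_def algebra_simps)
    have mem: "A + t *\<^sub>R D \<in> angle_structures" if "t \<in> {0..1}" for t
      unfolding line using convexD_alt[OF convex_angle_structures AB] that by simp
    have "concave_on {0..1} (\<lambda>t. energy (A + t *\<^sub>R D))"
    proof (rule f''_le0_imp_concave)
      fix t :: real assume t: "t \<in> {0..1}"
      show "((\<lambda>t. energy (A + t *\<^sub>R D)) has_real_derivative
          (\<Sum>f\<in>UNIV. \<Sum>c\<in>UNIV. - ln (2 * sin ((A + t *\<^sub>R D) $ f $ c)) * D $ f $ c)) (at t)"
        by (rule energy_has_derivative[OF mem[OF t]])
      show "((\<lambda>t. \<Sum>f\<in>UNIV. \<Sum>c\<in>UNIV. - ln (2 * sin ((A + t *\<^sub>R D) $ f $ c)) * D $ f $ c)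
          has_real_derivative
          (\<Sum>f\<in>UNIV. \<Sum>c\<in>UNIV. - (cot ((A + t *\<^sub>R D) $ f $ c) * (D $ f $ c)\<^sup>2))) (at t)"
      proof (intro DERIV_sum)
        fix f :: 'f and c
        have "0 < sin ((A + t *\<^sub>R D) $ f $ c)"
          by (intro sin_gt_zero angle_bounds[OF mem[OF t]])
        then show "((\<lambda>t. - ln (2 * sin ((A + t *\<^sub>R D) $ f $ c)) * D $ f $ c) has_real_derivative
            - (cot ((A + t *\<^sub>R D) $ f $ c) * (D $ f $ c)\<^sup>2)) (at t)"
          by (auto intro!: derivative_eq_intros simp: cot_def power2_eq_square)
      qed
      show "(\<Sum>f\<in>UNIV. \<Sum>c\<in>UNIV. - (cot ((A + t *\<^sub>R D) $ f $ c) * (D $ f $ c)\<^sup>2)) \<le> 0"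
      proof (rule sum_nonpos)
        fix f :: 'f
        let ?a = "\<lambda>c. (A + t *\<^sub>R D) $ f $ c"
        have "D $ f $ 1 + D $ f $ 2 + D $ f $ 3 = 0"
          using AB by (simp add: D_def angle_structures_def algebra_simps)
        moreover have "?a 1 + ?a 2 + ?a 3 = pi"
          using mem[OF t] unfolding angle_structures_def by blast
        ultimately have "0 \<le> cot (?a 1) * (D $ f $ 1)\<^sup>2 + cot (?a 2) * (D $ f $ 2)\<^sup>2
            + cot (?a 3) * (D $ f $ 3)\<^sup>2"
          using angle_bounds(1)[OF mem[OF t]] by (intro cot_form_nonneg) auto
        then show "(\<Sum>c\<in>UNIV. - (cot (?a c) * (D $ f $ c)\<^sup>2)) \<le> 0"
          by (simp add: sum_3)
      qed
    qed simp
    from concave_onD[OF this, of u 0 1] show ?thesis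
      using u unfolding line by simp
  qed
  then have "convex_on angle_structures (\<lambda>A::real^3^'f. - energy A)"
    by (intro convex_onI convex_angle_structures) (auto simp: algebra_simps)
  then show ?thesis
    by (simp add: concave_on_def)
qed

section \<open>Signed areas in the plane\<close>

text \<open>Twice the signed area of the triangle. It is affine in \<open>c\<close> and, for
  distinct \<open>a\<close> and \<open>b\<close>, positive exactly to the left of the line from
  \<open>a\<close> to \<open>b\<close>.\<close>

definition orient :: "complex \<Rightarrow> complex \<Rightarrow> complex \<Rightarrow> real" where
  "orient a b c = Im (cnj (b - a) * (c - a))"

lemma counterclockwise_iff_orient: "counterclockwise a b c \<longleftrightarrow> 0 < orient a b c"
  by (simp add: counterclockwise_def orient_def)

lemma orient_cyclic: "orient b c a = orient a b c"
  by (simp add: orient_def algebra_simps)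

lemma orient_degenerate [simp]: "orient a a b = 0" "orient a b a = 0" "orient a b b = 0"
  by (simp_all add: orient_def algebra_simps)

text \<open>The areas of the three subtriangles at \<open>y\<close> are its barycentric coordinates,
  left undivided so that degenerate triangles need no exception.\<close>

lemma orient_barycentric:
  "orient a b c *\<^sub>R y = orient b c y *\<^sub>R a + orient c a y *\<^sub>R b + orient a b y *\<^sub>R c"
  by (simp add: orient_def complex_eq_iff algebra_simps)

lemma orient_sum: "orient b c y + orient c a y + orient a b y = orient a b c"
  by (simp add: orient_def algebra_simps)

lemma orient_segment:
  assumes "y \<in> closed_segment a b"
  shows "orient a b y = 0"
proof -
  obtain u where y: "y = (1 - u) *\<^sub>R a + u *\<^sub>R b"
    using assms by (auto simp: in_segment)
  show ?thesis
    unfolding y orient_def by (simp add: algebra_simps)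
qed

text \<open>The added vector is \<open>b - a\<close> turned left by a right angle, so positive
  \<open>t\<close> moves to the left of the edge.\<close>

lemma orient_add_normal:
  "orient a b (y + t *\<^sub>R (\<i> * (b - a))) = orient a b y + t * (cmod (b - a))\<^sup>2"
  unfolding cmod_power2 by (simp add: orient_def power2_eq_square algebra_simps)

lemma orient_inner: "orient a b y = (\<i> * (b - a)) \<bullet> y - (\<i> * (b - a)) \<bullet> a"
  by (simp add: orient_def inner_complex_def algebra_simps)

lemma convex_hull_subset_left:
  assumes "0 < orient a b c"
  shows "convex hull {a, b, c} \<subseteq> {y. 0 \<le> orient a b y}"
proof (rule hull_minimal)
  have "{y. 0 \<le> orient a b y} = {y. (\<i> * (b - a)) \<bullet> a \<le> (\<i> * (b - a)) \<bullet> y}"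
    by (auto simp: orient_inner)
  then show "convex {y. 0 \<le> orient a b y}"
    by (simp only: convex_halfspace_ge)
qed (use assms in auto)

lemma continuous_on_orient: "continuous_on S (orient a b)"
  unfolding orient_def[abs_def] by (intro continuous_intros)

text \<open>The three strict inequalities cut out an open set, and dividing the areas by their sum
  yields convex coefficients.\<close>

lemma orient_interior_triangle:
  assumes "0 < orient a b y" "0 < orient b c y" "0 < orient c a y"
  shows "y \<in> interior (convex hull {a, b, c})"
proof (rule interiorI)
  let ?U = "{y. 0 < orient a b y} \<inter> {y. 0 < orient b c y} \<inter> {y. 0 < orient c a y}"
  have "open {y. 0 < orient d e y}" for d e
    by (intro open_Collect_less continuous_on_const continuous_on_orient)
  then show "open ?U"
    by (intro open_Int)
  show "y \<in> ?U"
    using assms by simp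
  show "?U \<subseteq> convex hull {a, b, c}"
  proof
    fix z assume z: "z \<in> ?U"
    define s where "s = orient a b c"
    have sum: "orient b c z + orient c a z + orient a b z = s"
      unfolding s_def by (rule orient_sum)
    then have s: "0 < s"
      using z by auto
    have "z = (1 / s) *\<^sub>R (s *\<^sub>R z)"
      using s by simp
    also have "s *\<^sub>R z = orient b c z *\<^sub>R a + orient c a z *\<^sub>R b + orient a b z *\<^sub>R c"
      unfolding s_def by (rule orient_barycentric)
    finally have "z = (orient b c z / s) *\<^sub>R a + (orient c a z / s) *\<^sub>R b + (orient a b z / s) *\<^sub>R c"
      by (simp add: scaleR_add_right)
    moreover have "orient b c z / s + orient c a z / s + orient a b z / s = 1"
      using s sum by (simp add: add_divide_distrib[symmetric])
    moreover have nonneg: "0 \<le> orient b c z / s" "0 \<le> orient c a z / s" "0 \<le> orient a b z / s"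
      using z s by auto
    ultimately show "z \<in> convex hull {a, b, c}"
      unfolding convex_hull_3 using nonneg by blast
  qed
qed

text \<open>At the midpoint of the edge the other two areas are half that of the triangle, hence
  stay positive nearby; moving left makes the third positive.\<close>

lemma eventually_interior_triangle:
  assumes "0 < orient a b c"
  shows "\<forall>\<^sub>F t in at_right 0.
    midpoint a b + t *\<^sub>R (\<i> * (b - a)) \<in> interior (convex hull {a, b, c})"
proof -
  let ?y = "\<lambda>t. midpoint a b + t *\<^sub>R (\<i> * (b - a))"
  have ne: "a \<noteq> b"
    using assms by auto
  have lim: "((\<lambda>t. orient d e (?y t)) \<longlongrightarrow> orient d e (?y 0)) (at_right 0)" for d e
    unfolding orient_def by (intro tendsto_intros)
  have "orient b c (?y 0) = orient a b c / 2" "orient c a (?y 0) = orient a b c / 2"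
    by (simp_all add: orient_def midpoint_def algebra_simps)
  then have "0 < orient b c (?y 0)" "0 < orient c a (?y 0)"
    using assms by auto
  then have "\<forall>\<^sub>F t in at_right 0. 0 < orient b c (?y t)" "\<forall>\<^sub>F t in at_right 0. 0 < orient c a (?y t)"
    using order_tendstoD(1)[OF lim] by blast+
  moreover have "\<forall>\<^sub>F t in at_right 0. 0 < (t::real)"
    by (rule eventually_at_right_less)
  ultimately show ?thesis
  proof eventually_elim
    case (elim t)
    have "orient a b (?y t) = t * (cmod (b - a))\<^sup>2"
      unfolding orient_add_normal by (simp add: orient_segment)
    then have "0 < orient a b (?y t)"
      using elim ne by simp
    then show ?case
      using elim by (intro orient_interior_triangle)
  qed
qed

text \<open>A half-edge from \<open>a\<close> to \<open>b\<close> is named by the triangle to its left and the corner at \<open>a\<close>.\<close>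
definition half_edges :: "('f \<Rightarrow> 3 \<Rightarrow> 'v) \<Rightarrow> 'v \<Rightarrow> 'v \<Rightarrow> ('f \<times> 3) set" where
  "half_edges tri a b = {(f, c). tri f c = a \<and> tri f (c + 1) = b}"

section \<open>Triangles on the two sides of an edge\<close>

context
  fixes p :: "'v::finite \<Rightarrow> complex" and tri :: "'f::finite \<Rightarrow> 3 \<Rightarrow> 'v"
  assumes mesh: "triangle_mesh p tri"
begin

lemma position_eq_iff: "p a = p b \<longleftrightarrow> a = b"
  using mesh by (simp add: triangle_mesh_def inj_eq)

text \<open>The mesh fixes the orientation at corners 1, 2, 3; cyclic invariance of the area carries
  it to any starting corner.\<close>

lemma mesh_orient: "0 < orient (p (tri f c)) (p (tri f (c + 1))) (p (tri f (c + 2)))"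
proof -
  have "0 < orient (p (tri f 1)) (p (tri f 2)) (p (tri f 3))"
    using mesh by (simp add: triangle_mesh_def counterclockwise_iff_orient)
  moreover have "orient (p (tri f 2)) (p (tri f 3)) (p (tri f 1))
      = orient (p (tri f 1)) (p (tri f 2)) (p (tri f 3))"
    "orient (p (tri f 3)) (p (tri f 1)) (p (tri f 2))
      = orient (p (tri f 1)) (p (tri f 2)) (p (tri f 3))"
    by (metis orient_cyclic)+
  moreover have "(1::3) + 1 = 2" "(1::3) + 2 = 3" "(2::3) + 1 = 3" "(2::3) + 2 = 1"
    "(3::3) + 1 = 1" "(3::3) + 2 = 2"
    by simp_all
  ultimately show ?thesis
    using exhaust_3[of c] by (elim disjE) (simp_all only:)
qed

lemma cell_eq: "cell p tri f = convex hull {p (tri f c), p (tri f (c + 1)), p (tri f (c + 2))}"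
proof -
  have "d \<in> {c, c + 1, c + 2}" for d
    using exhaust_3[of c] exhaust_3[of d] by auto
  then have corners: "UNIV = {c, c + 1, c + 2}"
    by blast
  show ?thesis
    unfolding cell_def corners by simp
qed

lemma mesh_corner_distinct: "tri f c \<noteq> tri f (c + 1)"
  using mesh_orient[of f c] by auto

lemma inj_tri: "inj (tri f)"
proof (rule injI)
  fix c d assume "tri f c = tri f d"
  then have "d \<noteq> c + 1" "c \<noteq> d + 1"
    using mesh_corner_distinct by metis+
  then show "c = d"
    using exhaust_3[of c] exhaust_3[of d] by auto
qed

lemma cell_Int_face: "(cell p tri f \<inter> cell p tri g) face_of cell p tri f"
  using mesh by (auto simp: triangle_mesh_def triangulation_def)

lemma vertex_in_cell: "p (tri f c) \<in> cell p tri f"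
  unfolding cell_def by (auto intro: hull_inc)

lemma closed_cell: "closed (cell p tri f)"
  unfolding cell_def by (intro compact_imp_closed finite_imp_compact_convex_hull) auto

text \<open>Two triangles to the left of the same half-edge share interior points just left of its
  midpoint. A face that meets the interior is the whole cell, so the cells, and by injectivity the
  triangles, coincide.\<close>

lemma half_edge_unique:
  assumes "(f, c) \<in> half_edges tri a b" "(g, d) \<in> half_edges tri a b"
  shows "(f, c) = (g, d)"
proof -
  from assms have eq: "tri g d = tri f c" "tri g (d + 1) = tri f (c + 1)"
    by (auto simp: half_edges_def)
  let ?y = "\<lambda>t. midpoint (p (tri f c)) (p (tri f (c + 1)))
    + t *\<^sub>R (\<i> * (p (tri f (c + 1)) - p (tri f c)))"
  have "\<forall>\<^sub>F t in at_right 0. ?y t \<in> interior (cell p tri f)"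
    using eventually_interior_triangle[OF mesh_orient[of f c]] by (simp only: cell_eq[of f c])
  moreover have "\<forall>\<^sub>F t in at_right 0. ?y t \<in> interior (cell p tri g)"
    using eventually_interior_triangle[OF mesh_orient[of g d]] by (simp only: cell_eq[of g d] eq)
  ultimately have "\<forall>\<^sub>F t in at_right (0::real). \<exists>y. y \<in> interior (cell p tri f) \<and> y \<in> interior (cell p tri g)"
    by eventually_elim blast
  then obtain y where y: "y \<in> interior (cell p tri f)" "y \<in> interior (cell p tri g)"
    by auto
  have "cell p tri f \<inter> cell p tri g = cell p tri f"
    using face_of_disjoint_interior[OF cell_Int_face[of f g]] y interior_subset by blast
  moreover have "cell p tri g \<inter> cell p tri f = cell p tri g"
    using face_of_disjoint_interior[OF cell_Int_face[of g f]] y interior_subset by blast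
  ultimately have "cell p tri f = cell p tri g"
    by blast
  then have "f = g"
    using mesh by (auto simp: triangle_mesh_def dest: injD)
  then show ?thesis
    using eq injD[OF inj_tri] by metis
qed

text \<open>A point inside an edge of \<open>f\<close> that lies in \<open>g\<close> forces the whole edge into the common face, and
  extreme points of a face of \<open>g\<close> are corners of \<open>g\<close>.\<close>
lemma common_vertex:
  assumes "x \<in> open_segment (p (tri f c)) (p (tri f d))" "x \<in> cell p tri g"
  shows "\<exists>e. tri g e = tri f c"
proof -
  let ?a = "p (tri f c)"
  have "convex (cell p tri f)"
    unfolding cell_def by (rule convex_convex_hull)
  then have "x \<in> cell p tri f"
    using assms(1) vertex_in_cell unfolding convex_contains_open_segment by blast
  then have in_g: "?a \<in> cell p tri f \<inter> cell p tri g"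
    using face_ofD[OF cell_Int_face assms(1)] assms(2) vertex_in_cell by blast
  have "?a extreme_point_of cell p tri f"
  proof -
    have "orient (p (tri f (c + 1))) (p (tri f (c + 2))) ?a \<noteq> 0"
      using mesh_orient[of f c] by (simp add: orient_cyclic)
    then have "?a \<notin> convex hull {p (tri f (c + 1)), p (tri f (c + 2))}"
      using orient_segment by (auto simp: segment_convex_hull[symmetric])
    then show ?thesis
      unfolding cell_eq[of f c] by (intro extreme_point_of_convex_hull_insert) auto
  qed
  then have "?a extreme_point_of (cell p tri f \<inter> cell p tri g)"
    using in_g extreme_point_of_face[OF cell_Int_face] by blast
  then have "?a extreme_point_of cell p tri g"
    using extreme_point_of_face[OF cell_Int_face[of g f]] by (simp add: Int_commute)
  then have "?a \<in> range (\<lambda>e. p (tri g e))"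
    unfolding cell_def by (rule extreme_point_of_convex_hull)
  then show ?thesis
    by (auto simp: position_eq_iff)
qed

text \<open>As \<open>x\<close> is interior to the region, points just right of the edge are still
  covered. A cell that covers such a point and contains \<open>x\<close> has \<open>a\<close> and
  \<open>b\<close> as corners, and being on the right it traverses the edge from \<open>b\<close> to
  \<open>a\<close>.\<close>

lemma opposite_half_edge:
  assumes "half_edges tri a b \<noteq> {}" "x \<in> open_segment (p a) (p b)" "x \<in> interior (region p tri)"
  shows "half_edges tri b a \<noteq> {}"
proof -
  obtain f c where f: "tri f c = a" "tri f (c + 1) = b"
    using assms(1) by (auto simp: half_edges_def)
  have "p a \<noteq> p b"
    using assms(2) by auto
  \<comment> \<open>Points just to the right of the edge near \<open>x\<close> must lie in a cell through \<open>x\<close>.\<close>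
  define K where "K = (\<Union>g\<in>{g. x \<notin> cell p tri g}. cell p tri g)"
  let ?y = "\<lambda>t. x - t *\<^sub>R (\<i> * (p b - p a))"
  have "open (interior (region p tri) - K)"
    unfolding K_def by (intro open_Diff open_interior closed_UN closed_cell ballI) auto
  moreover have "x \<in> interior (region p tri) - K"
    using assms(3) by (auto simp: K_def)
  moreover have "(?y \<longlongrightarrow> ?y 0) (at_right 0)"
    by (intro tendsto_intros)
  ultimately have "\<forall>\<^sub>F t in at_right 0. ?y t \<in> interior (region p tri) - K"
    by (intro topological_tendstoD) auto
  moreover have "\<forall>\<^sub>F t in at_right 0. 0 < (t::real)"
    by (rule eventually_at_right_less)
  ultimately have "\<forall>\<^sub>F t in at_right 0. 0 < t \<and> ?y t \<in> interior (region p tri) - K"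
    by eventually_elim simp
  then obtain t where t: "0 < t" "?y t \<in> interior (region p tri) - K"
    using eventually_happens'[OF trivial_limit_at_right_real] by blast
  then obtain g where "?y t \<in> cell p tri g"
    using interior_subset by (auto simp: region_def)
  with t have g: "?y t \<in> cell p tri g" "x \<in> cell p tri g"
    by (auto simp: K_def)
  obtain d where d: "tri g d = b"
    using common_vertex[of x f "c + 1" c g] g(2) assms(2) f open_segment_commute by metis
  obtain e where e: "tri g e = a"
    using common_vertex[of x f c "c + 1" g] g(2) assms(2) f by metis
  have "e \<noteq> d"
    using d e \<open>p a \<noteq> p b\<close> by auto
  then consider "e = d + 1" | "d = e + 1"
    using exhaust_3[of d] exhaust_3[of e] by auto
  then show ?thesis
  proof cases
    case 1
    then show ?thesis
      using d e by (auto simp: half_edges_def)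
  next
    case 2
    \<comment> \<open>With \<open>a\<close> followed by \<open>b\<close>, all of \<open>g\<close>
      would lie left of the edge, although it contains \<open>?y t\<close>, strictly to the
      right.\<close>
    have "orient (p a) (p b) x = 0"
      using assms(2) by (simp add: orient_segment open_segment_def)
    moreover have "orient (p a) (p b) (?y t) = orient (p a) (p b) x - t * (cmod (p b - p a))\<^sup>2"
      using orient_add_normal[of "p a" "p b" x "- t"] by simp
    ultimately have "orient (p a) (p b) (?y t) < 0"
      using t(1) \<open>p a \<noteq> p b\<close> by simp
    moreover have "0 \<le> orient (p a) (p b) (?y t)"
      using g(1) convex_hull_subset_left[OF mesh_orient[of g e]] e d 2 unfolding cell_eq[of g e]
      by auto
    ultimately show ?thesis by simp
  qed
qed

text \<open>Each count is 0 or 1. Even when \<open>w\<close> is on the boundary, points of the edge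
  close to \<open>v\<close> are interior to the region, and one such point gives triangles on both
  sides or on neither.\<close>

lemma card_half_edges_opposite:
  assumes "interior_vertex p tri v"
  shows "card (half_edges tri v w) = card (half_edges tri w v)"
proof (cases "v = w")
  case False
  have "p v \<noteq> p w"
    using False by (simp add: position_eq_iff)
  have "p v \<in> region p tri"
  proof -
    obtain f c where "tri f c = v"
      using mesh unfolding triangle_mesh_def by metis
    then show ?thesis
      using vertex_in_cell[of f c] by (auto simp: region_def)
  qed
  then have "p v \<in> interior (region p tri)"
    using assms closure_subset by (auto simp: interior_vertex_def frontier_def)
  moreover have "p v \<in> closure (open_segment (p v) (p w))"
    using \<open>p v \<noteq> p w\<close> by simp
  ultimately obtain x where x: "x \<in> open_segment (p v) (p w)" "x \<in> interior (region p tri)"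
    using closure_iff_nhds_not_empty[of "p v"] open_interior by blast
  have "half_edges tri v w = {} \<longleftrightarrow> half_edges tri w v = {}"
    using opposite_half_edge x by (metis open_segment_commute)
  moreover have "card (half_edges tri a b) = (if half_edges tri a b = {} then 0 else 1)" for a b
  proof -
    have "half_edges tri a b = {q}" if "q \<in> half_edges tri a b" for q
      using half_edge_unique that by (cases q) auto
    then show ?thesis
      by (metis card.empty card_1_singleton_iff One_nat_def equals0I)
  qed
  ultimately show ?thesis by simp
qed simp

end


section \<open>Varying the angles around a vertex\<close>

lemma corner_numerals: "(3::3) = 0" "(4::3) = 1" "(5::3) = 2"
  by simp_all

text \<open>Corners are counted from the one that changes: in a triangle at \<open>v\<close>, the corner \<open>c\<close> with \<open>v\<close> at
  \<open>c + 1\<close> is the one two steps after \<open>v\<close>.\<close>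
definition link_direction :: "('f::finite \<Rightarrow> 3 \<Rightarrow> 'v) \<Rightarrow> 'v \<Rightarrow> real^3^'f" where
  "link_direction tri v =
    (\<chi> f c. of_bool (tri f (c + 1) = v) - of_bool (tri f (c + 2) = v))"

lemma link_direction_sum:
  "link_direction tri v $ f $ 1 + link_direction tri v $ f $ 2 + link_direction tri v $ f $ 3 = 0"
  by (simp add: link_direction_def corner_numerals)

text \<open>In a triangle at \<open>w\<close>, the angle at \<open>w\<close> grows if
  \<open>v\<close> is the next corner, giving a half-edge from \<open>w\<close> to \<open>v\<close>,
  and shrinks if \<open>v\<close> is two corners on, giving one from \<open>v\<close> to
  \<open>w\<close>.\<close>

lemma angle_sum_link_direction:
  "angle_sum tri w (link_direction tri v)
    = real (card (half_edges tri w v)) - real (card (half_edges tri v w))"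
proof -
  have "angle_sum tri w (link_direction tri v)
      = (\<Sum>x\<in>{(f, c). tri f c = w}. of_bool (tri (fst x) (snd x + 1) = v))
        - (\<Sum>x\<in>{(f, c). tri f c = w}. of_bool (tri (fst x) (snd x + 2) = v))"
    by (simp add: angle_sum_def link_direction_def case_prod_unfold sum_subtractf)
  also have "(\<Sum>x\<in>{(f, c). tri f c = w}. of_bool (tri (fst x) (snd x + 1) = v))
      = real (card (half_edges tri w v))"
    unfolding of_bool_def by (subst sum.inter_filter[symmetric]) (auto simp: half_edges_def case_prod_unfold)
  also have "(\<Sum>x\<in>{(f, c). tri f c = w}. of_bool (tri (fst x) (snd x + 2) = v))
      = real (card {(f, c). tri f c = w \<and> tri f (c + 2) = v})"
    unfolding of_bool_def by (subst sum.inter_filter[symmetric]) (auto simp: case_prod_unfold)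
  \<comment> \<open>A half-edge from \<open>v\<close> is named by the corner at \<open>v\<close>,
    here \<open>c + 2\<close>; adding 1 returns to \<open>c\<close> modulo 3.\<close>
  also have "card {(f, c). tri f c = w \<and> tri f (c + 2) = v} = card (half_edges tri v w)"
    by (rule bij_betw_same_card[where f = "\<lambda>(f, c). (f, c + 2)"],
        rule bij_betw_byWitness[where f' = "\<lambda>(f, c). (f, c + 1)"])
      (auto simp: half_edges_def corner_numerals)
  finally show ?thesis .
qed

text \<open>The terms \<open>ln 2\<close> cancel within each triangle, where the entries of the
  direction sum to 0. The rest is regrouped by the corner that carries \<open>v\<close>.\<close>

lemma directional_derivative_eq_holonomy:
  assumes "A \<in> angle_structures"
  shows "(\<Sum>f\<in>UNIV. \<Sum>c\<in>UNIV. - ln (2 * sin (A $ f $ c)) * link_direction tri v $ f $ c)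
    = - holonomy tri v A"
proof -
  have ln_eq: "ln (2 * sin (A $ f $ c)) = ln 2 + ln (sin (A $ f $ c))" for f c
    using sin_gt_zero[OF angle_bounds[OF assms, of f c]] by (simp add: ln_mult)
  let ?h = "\<lambda>f c. ln (sin (A $ f $ (c + 2))) - ln (sin (A $ f $ (c + 1)))"
  have "holonomy tri v A = (\<Sum>x\<in>UNIV. if tri (fst x) (snd x) = v then ?h (fst x) (snd x) else 0)"
    unfolding holonomy_def by (subst sum.inter_filter[symmetric]) (auto simp: case_prod_unfold)
  also have "\<dots> = (\<Sum>f\<in>UNIV. \<Sum>c\<in>UNIV. of_bool (tri f c = v) * ?h f c)"
    unfolding sum.cartesian_product UNIV_Times_UNIV
    by (rule sum.cong) (auto simp: case_prod_unfold)
  finally have "holonomy tri v A = (\<Sum>f\<in>UNIV. \<Sum>c\<in>UNIV. of_bool (tri f c = v) * ?h f c)" .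
  moreover have "(\<Sum>c\<in>UNIV. - ln (2 * sin (A $ f $ c)) * link_direction tri v $ f $ c)
      = - (\<Sum>c\<in>UNIV. of_bool (tri f c = v) * ?h f c)" for f
    by (simp add: ln_eq sum_3 link_direction_def corner_numerals algebra_simps)
  ultimately show ?thesis
    by (simp add: sum_negf)
qed

text \<open>Positivity is finitely many open conditions, and a direction of zero sum keeps the total
  of each triangle. Both signs of \<open>t\<close> are covered, as a two-sided derivative test
  needs.\<close>

lemma eventually_angle_structure:
  assumes A: "A \<in> angle_structures" and D: "\<And>f. D $ f $ 1 + D $ f $ 2 + D $ f $ 3 = 0"
  shows "\<forall>\<^sub>F t in at 0. A + t *\<^sub>R D \<in> angle_structures"
proof -
  have "\<forall>\<^sub>F t in at 0. 0 < (A + t *\<^sub>R D) $ f $ c" for f c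
  proof (rule order_tendstoD(1))
    show "((\<lambda>t. (A + t *\<^sub>R D) $ f $ c) \<longlongrightarrow> (A + 0 *\<^sub>R D) $ f $ c) (at 0)"
      by (intro tendsto_intros)
  qed (use angle_bounds(1)[OF A] in simp)
  then have "\<forall>\<^sub>F t in at 0. \<forall>f c. 0 < (A + t *\<^sub>R D) $ f $ c"
    by (simp only: eventually_all_finite)
  then show ?thesis
  proof eventually_elim
    case (elim t)
    have "(A + t *\<^sub>R D) $ f $ 1 + (A + t *\<^sub>R D) $ f $ 2 + (A + t *\<^sub>R D) $ f $ 3
        = (A $ f $ 1 + A $ f $ 2 + A $ f $ 3) + t * (D $ f $ 1 + D $ f $ 2 + D $ f $ 3)" for f
      by (simp add: algebra_simps)
    moreover have "A $ f $ 1 + A $ f $ 2 + A $ f $ 3 = pi" for f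
      using A by (simp add: angle_structures_def)
    ultimately have "(A + t *\<^sub>R D) $ f $ 1 + (A + t *\<^sub>R D) $ f $ 2 + (A + t *\<^sub>R D) $ f $ 3 = pi" for f
      by (simp only: D)
    then show ?case
      using elim unfolding angle_structures_def by blast
  qed
qed

section \<open>First-order condition at extremal points\<close>

lemma extremal_point_derivative_zero:
  fixes A D :: "'a::real_normed_vector"
  assumes ext: "extremal_point_on S g A"
    and mem: "\<forall>\<^sub>F t in at (0::real). A + t *\<^sub>R D \<in> S"
    and deriv: "((\<lambda>t. g (A + t *\<^sub>R D)) has_real_derivative l) (at 0)"
  shows "l = 0"
proof -
  have lim: "((\<lambda>t. A + t *\<^sub>R D) \<longlongrightarrow> A) (at 0)"
    by (auto intro!: tendsto_eq_intros)
  \<comment> \<open>The filter \<open>at A within S\<close> omits \<open>A\<close>, whereas the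
    local extremum rules include \<open>t = 0\<close>, and the line stays at \<open>A\<close> when
    \<open>D\<close> is 0; hence the separate assumption \<open>P A\<close>.\<close>
  have transfer: "\<exists>d>0. \<forall>t. \<bar>0 - t\<bar> < d \<longrightarrow> P (A + t *\<^sub>R D)"
    if ev: "\<forall>\<^sub>F y in at A within S. P y" and "P A" for P
  proof -
    have "\<forall>\<^sub>F y in nhds A. y \<in> S \<longrightarrow> P y"
      using ev \<open>P A\<close> by (auto simp: eventually_at_filter elim: eventually_mono)
    then have "\<forall>\<^sub>F t in at 0. A + t *\<^sub>R D \<in> S \<longrightarrow> P (A + t *\<^sub>R D)"
      using lim by (auto simp: filterlim_iff)
    with mem have "\<forall>\<^sub>F t in at 0. P (A + t *\<^sub>R D)"
      by eventually_elim simp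
    then obtain d where d: "0 < d" "\<And>t. t \<noteq> 0 \<Longrightarrow> \<bar>t\<bar> < d \<Longrightarrow> P (A + t *\<^sub>R D)"
      by (auto simp: eventually_at dist_real_def)
    have "P (A + t *\<^sub>R D)" if "\<bar>0 - t\<bar> < d" for t
      using d(2)[of t] \<open>P A\<close> that by (cases "t = 0") auto
    with d(1) show ?thesis by blast
  qed
  from ext consider "\<forall>\<^sub>F y in at A within S. g y \<le> g A" | "\<forall>\<^sub>F y in at A within S. g A \<le> g y"
    by (auto simp: extremal_point_on_def)
  then show ?thesis
  proof cases
    case 1
    then obtain d where "0 < d" "\<forall>t. \<bar>0 - t\<bar> < d \<longrightarrow> g (A + t *\<^sub>R D) \<le> g A"
      using transfer[of "\<lambda>y. g y \<le> g A"] by blast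
    then show ?thesis
      using DERIV_local_max[OF deriv, of d] by simp
  next
    case 2
    then obtain d where "0 < d" "\<forall>t. \<bar>0 - t\<bar> < d \<longrightarrow> g A \<le> g (A + t *\<^sub>R D)"
      using transfer[of "\<lambda>y. g A \<le> g y"] by blast
    then show ?thesis
      using DERIV_local_min[OF deriv, of d] by simp
  qed
qed

theorem lemma3p1:
  fixes p :: "'v::finite \<Rightarrow> complex" and tri :: "'f::finite \<Rightarrow> 3 \<Rightarrow> 'v" and \<Theta> :: "real^'v"
  assumes "triangle_mesh p tri"
  shows "concave_on (prescribed_angle_structures tri \<Theta>) energy \<and>
    (\<forall>A. extremal_point_on (prescribed_angle_structures tri \<Theta>) energy A \<longrightarrow>
      (\<forall>v. interior_vertex p tri v \<longrightarrow> holonomy tri v A = 0))"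
proof (intro conjI allI impI)
  show "concave_on (prescribed_angle_structures tri \<Theta>) energy"
    using concave_on_energy convex_prescribed_angle_structures
    by (auto simp: concave_on_iff prescribed_angle_structures_def)
next
  fix A v
  assume ext: "extremal_point_on (prescribed_angle_structures tri \<Theta>) energy A"
    and v: "interior_vertex p tri v"
  let ?D = "link_direction tri v"
  have A: "A \<in> angle_structures" "\<And>w. angle_sum tri w A = \<Theta> $ w"
    using ext by (auto simp: extremal_point_on_def prescribed_angle_structures_def)
  \<comment> \<open>The counts balance for every \<open>w\<close>, on the boundary or not, since
    only \<open>v\<close> has to be interior.\<close>
  have "angle_sum tri w (A + t *\<^sub>R ?D) = \<Theta> $ w" for w t
    using card_half_edges_opposite[OF assms v, of w]
    by (simp add: linear_add[OF angle_sum_linear] linear_cmul[OF angle_sum_linear]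
      angle_sum_link_direction A)
  moreover have "\<forall>\<^sub>F t in at 0. A + t *\<^sub>R ?D \<in> angle_structures"
    by (intro eventually_angle_structure A link_direction_sum)
  ultimately have "\<forall>\<^sub>F t in at 0. A + t *\<^sub>R ?D \<in> prescribed_angle_structures tri \<Theta>"
    by (simp add: prescribed_angle_structures_def)
  moreover have "((\<lambda>t. energy (A + t *\<^sub>R ?D)) has_real_derivative - holonomy tri v A) (at 0)"
    using energy_has_derivative[of A 0 ?D] A(1) directional_derivative_eq_holonomy[OF A(1), of tri v]
    by simp
  ultimately show "holonomy tri v A = 0"
    using extremal_point_derivative_zero[OF ext] by fastforce
qed

end
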